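(* Let $\mathbb K$ be a field of characteristic $0$, let $(A,* )$ be a Malcev algebra over $\mathbb K$ and let $\beta$ be any endomorphism of $(A,* )$. Define on $A$ the operations $$x\,\tilde{*}\,y:=\beta(x*y),\qquad \{x,y,z\}:=\beta^{2}\big((x*y)*z-(y*z)*x-(z*x)*y\big)$$ for all $x,y,z\in A$. Then $(A,\tilde{*},\{\,,\,,\},\beta)$ is a Hom-Lie-Yamaguti algebra.
   Context: A Malcev algebra $(A,* )$ is a $\mathbb K$-vector space with a bilinear operation $*$ that is skew-symmetric ($x*y=-y*x$) and satisfies the Malcev identity $J(x,y,x*z)=J(x,y,z)*x$ for all $x,y,z\in A$, where $J(x,y,z):=(x*y)*z+(y*z)*x+(z*x)*y$. An endomorphism of $(A,* )$ is a linear map $\beta:A\to A$ with $\beta(x*y)=\beta(x)*\beta(y)$ for all $x,y$. A Hom-Lie-Yamaguti algebra (Hom-LY algebra) is a quadruple $(L,*,\{\,,\,,\},\alpha)$ in which $L$ is a $\mathbb K$-vector space, $*$ is a bilinear binary operation on $L$, $\{\,,\,,\}$ is a trilinear ternary operation on $L$, and $\alpha:L\to L$ is a linear map, such that for all $u,v,w,x,y,z\in L$ (with $\sigma$ denoting the sum over cyclic permutations of $x,y,z$): (B1) $\alpha(x*y)=\alpha(x)*\alpha(y)$; (B2) $\alpha(\{x,y,z\})=\{\alpha(x),\alpha(y),\alpha(z)\}$; (B3) $x*y=-y*x$; (B4) $\{x,y,z\}=-\{y,x,z\}$; (B5) $\sigma[(x*y)*\alpha(z)+\{x,y,z\}]=0$;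 (B6) $\sigma[\{x*y,\alpha(z),\alpha(u)\}+\{z*y,\alpha(x),\alpha(u)\}]=0$; (B7) $\{\alpha(x),\alpha(y),u*v\}=\{x,y,u\}*\alpha^{2}(v)+\alpha^{2}(u)*\{x,y,v\}$; (B8) $\{\alpha^{2}(x),\alpha^{2}(y),\{\alpha^{2}(u),\alpha^{2}(v),w\}\}=\{\{x,y,\alpha^{2}(u)\},\alpha^{4}(v),\alpha^{2}(w)\}+\{\alpha^{4}(u),\{x,y,\alpha^{2}(v)\},\alpha^{2}(w)\}+\{\alpha^{4}(u),\alpha^{4}(v),\{x,y,w\}\}$. *)

theory Defs
  imports Complex_Main
begin

definition bilinear_op :: "('k::field \<Rightarrow> 'a::ab_group_add \<Rightarrow> 'a) \<Rightarrow> ('a \<Rightarrow> 'a \<Rightarrow> 'a) \<Rightarrow> bool" where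
  "bilinear_op scale m \<longleftrightarrow>
     (\<forall>y. Vector_Spaces.linear scale scale (\<lambda>x. m x y)) \<and>
     (\<forall>x. Vector_Spaces.linear scale scale (\<lambda>y. m x y))"

definition trilinear_op :: "('k::field \<Rightarrow> 'a::ab_group_add \<Rightarrow> 'a) \<Rightarrow> ('a \<Rightarrow> 'a \<Rightarrow> 'a \<Rightarrow> 'a) \<Rightarrow> bool" where
  "trilinear_op scale t \<longleftrightarrow>
     (\<forall>y z. Vector_Spaces.linear scale scale (\<lambda>x. t x y z)) \<and>
     (\<forall>x z. Vector_Spaces.linear scale scale (\<lambda>y. t x y z)) \<and>
     (\<forall>x y. Vector_Spaces.linear scale scale (\<lambda>z. t x y z))"

definition cyclic_sum :: "('a \<Rightarrow> 'a \<Rightarrow> 'a \<Rightarrow> 'a::ab_group_add) \<Rightarrow> 'a \<Rightarrow> 'a \<Rightarrow> 'a \<Rightarrow> 'a" where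
  "cyclic_sum f x y z = f x y z + f y z x + f z x y"

definition jacobian :: "('a \<Rightarrow> 'a \<Rightarrow> 'a::ab_group_add) \<Rightarrow> 'a \<Rightarrow> 'a \<Rightarrow> 'a \<Rightarrow> 'a" where
  "jacobian m x y z = m (m x y) z + m (m y z) x + m (m z x) y"

locale malcev_algebra = vector_space scale
  for scale :: "'k::field \<Rightarrow> 'a::ab_group_add \<Rightarrow> 'a" (infixr \<open>*s\<close> 75) +
  fixes mult :: "'a \<Rightarrow> 'a \<Rightarrow> 'a" (infixl \<open>\<star>\<close> 70)
  assumes bilinear: "bilinear_op scale mult"
    and skew: "x \<star> y = - (y \<star> x)"
    and malcev: "jacobian mult x y (x \<star> z) = jacobian mult x y z \<star> x"

definition algebra_endomorphism ::
  "('k::field \<Rightarrow> 'a::ab_group_add \<Rightarrow> 'a) \<Rightarrow> ('a \<Rightarrow> 'a \<Rightarrow> 'a) \<Rightarrow> ('a \<Rightarrow> 'a) \<Rightarrow> bool" where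
  "algebra_endomorphism scale m \<beta> \<longleftrightarrow>
     Vector_Spaces.linear scale scale \<beta> \<and> (\<forall>x y. \<beta> (m x y) = m (\<beta> x) (\<beta> y))"

text \<open>The sum in (B6) keeps its second summand. That summand makes (B6) a consequence of
  skew-symmetry and trilinearity; the usual Lie-Yamaguti axiom has only the first summand.
  In (B5) and (B6) the cyclic sum runs over \<open>x\<close>, \<open>y\<close>, \<open>z\<close>, with \<open>u\<close> fixed.\<close>

locale hom_lie_yamaguti_algebra = vector_space scale
  for scale :: "'k::field \<Rightarrow> 'a::ab_group_add \<Rightarrow> 'a" (infixr \<open>*s\<close> 75) +
  fixes mult :: "'a \<Rightarrow> 'a \<Rightarrow> 'a" (infixl \<open>\<star>\<close> 70)
    and tri :: "'a \<Rightarrow> 'a \<Rightarrow> 'a \<Rightarrow> 'a"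
    and \<alpha> :: "'a \<Rightarrow> 'a"
  assumes bilinear: "bilinear_op scale mult"
    and trilinear: "trilinear_op scale tri"
    and twist_linear: "Vector_Spaces.linear scale scale \<alpha>"
    and B1: "\<alpha> (x \<star> y) = \<alpha> x \<star> \<alpha> y"
    and B2: "\<alpha> (tri x y z) = tri (\<alpha> x) (\<alpha> y) (\<alpha> z)"
    and B3: "x \<star> y = - (y \<star> x)"
    and B4: "tri x y z = - tri y x z"
    and B5: "cyclic_sum (\<lambda>x y z. (x \<star> y) \<star> \<alpha> z + tri x y z) x y z = 0"
    and B6: "cyclic_sum (\<lambda>x y z. tri (x \<star> y) (\<alpha> z) (\<alpha> u) + tri (z \<star> y) (\<alpha> x) (\<alpha> u)) x y z = 0"
    and B7: "tri (\<alpha> x) (\<alpha> y) (u \<star> v) =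
               tri x y u \<star> (\<alpha> ^^ 2) v + (\<alpha> ^^ 2) u \<star> tri x y v"
    and B8: "tri ((\<alpha> ^^ 2) x) ((\<alpha> ^^ 2) y) (tri ((\<alpha> ^^ 2) u) ((\<alpha> ^^ 2) v) w) =
               tri (tri x y ((\<alpha> ^^ 2) u)) ((\<alpha> ^^ 4) v) ((\<alpha> ^^ 2) w)
             + tri ((\<alpha> ^^ 4) u) (tri x y ((\<alpha> ^^ 2) v)) ((\<alpha> ^^ 2) w)
             + tri ((\<alpha> ^^ 4) u) ((\<alpha> ^^ 4) v) (tri x y w)"

end

theory Submission imports Defs begin

text \<open>
  Untwisted, the ternary operation is \<open>D x y z = (x \<star> y) \<star> z - (y \<star> z) \<star> x - (z \<star> x) \<star> y\<close>,
  and each occurrence of \<open>\<beta>\<close> in the axioms can be pushed down to the variables, because \<open>\<beta>\<close> is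
  an endomorphism. On every variable the two sides of an axiom then carry the same power of
  \<open>\<beta>\<close>, so each axiom is an instance of its untwisted form, and the Hom-structure follows from
  the Lie-Yamaguti structure of the Malcev algebra itself. The untwisted (B5) holds because
  the cyclic sum of \<open>D\<close> is minus the Jacobian, (B6) because its summands cancel in pairs, and (B7)
  says that every \<open>D x y\<close> is a derivation of the product; (B8) follows from this, since \<open>D\<close> is
  built from the product.

  The derivation property is the core. Let \<open>J\<close> be the Jacobian. Expressing the Leibniz defect of
  \<open>D x y\<close> in terms of \<open>J\<close> alone uses only skew-symmetry (\<open>leibniz_defect_jacobian\<close>). The Malcev
  identity enters through Sagle's function
  \<open>f a b c d = J (a \<star> b) c d - J b c d \<star> a + J a c d \<star> b\<close>: the identity says that \<open>f\<close>
  vanishes when its first and third arguments agree, hence \<open>f\<close> is alternating in all four arguments.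
  Rewriting every \<open>J (a \<star> b) c d\<close> in the Leibniz defect through \<open>f\<close> leaves
  \<open>3 f x y u v + 2 G x y u v\<close>, where \<open>G\<close> is the alternating sum of the terms \<open>J b c d \<star> a\<close>. On the
  other hand, adding the six signed values of \<open>f\<close> that belong to the six pairs of arguments gives
  \<open>6 f = - 4 G\<close> (\<open>six_sagle\<close>). Dividing by \<open>2\<close>, the Leibniz defect is zero.
\<close>

section \<open>The Jacobian of a skew-symmetric product\<close>

context malcev_algebra
begin

lemma linear_mult_left: "Vector_Spaces.linear scale scale (\<lambda>x. x \<star> y)"
  and linear_mult_right: "Vector_Spaces.linear scale scale (\<lambda>y. x \<star> y)"
  using bilinear by (simp_all add: bilinear_op_def)

lemmas mult_linear_simps =
  module_hom.add[OF module_hom_linearI[OF linear_mult_left]]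
  module_hom.diff[OF module_hom_linearI[OF linear_mult_left]]
  module_hom.neg[OF module_hom_linearI[OF linear_mult_left]]
  module_hom.zero[OF module_hom_linearI[OF linear_mult_left]]
  module_hom.scale[OF module_hom_linearI[OF linear_mult_left]]
  module_hom.add[OF module_hom_linearI[OF linear_mult_right]]
  module_hom.diff[OF module_hom_linearI[OF linear_mult_right]]
  module_hom.neg[OF module_hom_linearI[OF linear_mult_right]]
  module_hom.zero[OF module_hom_linearI[OF linear_mult_right]]
  module_hom.scale[OF module_hom_linearI[OF linear_mult_right]]

abbreviation J :: "'a \<Rightarrow> 'a \<Rightarrow> 'a \<Rightarrow> 'a" where "J \<equiv> jacobian mult"

lemma jacobian_cycle: "J y z x = J x y z"
  by (simp add: jacobian_def algebra_simps)

lemma jacobian_swap12: "J y x z = - J x y z"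
  using skew[of y x] skew[of z y] skew[of x z]
  by (simp add: jacobian_def mult_linear_simps)

lemma jacobian_swap23: "J x z y = - J x y z"
proof -
  have "J x z y = J z y x" by (rule jacobian_cycle[symmetric])
  also have "\<dots> = - J y z x" by (rule jacobian_swap12)
  also have "J y z x = J x y z" by (rule jacobian_cycle)
  finally show ?thesis .
qed

lemma double_eq_zero_imp:
  fixes x :: 'a
  assumes "(2::'k) \<noteq> 0" and "x + x = 0"
  shows "x = 0"
proof -
  have "(2::'k) *s x = x + x"
    using scale_left_distrib[of 1 1 x] by simp
  with assms show ?thesis by simp
qed

lemma mult_self:
  assumes "(2::'k) \<noteq> 0"
  shows "x \<star> x = 0"
  using skew[of x x] double_eq_zero_imp[OF assms] by (metis add.right_inverse)

text \<open>Up to sign this is the coboundary of \<open>J\<close> as an alternating 3-cochain, without the terms in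
  which a product is inserted into \<open>J\<close>.\<close>

definition jacobian_boundary :: "'a \<Rightarrow> 'a \<Rightarrow> 'a \<Rightarrow> 'a \<Rightarrow> 'a" where
  "jacobian_boundary a b c d =
     J b c d \<star> a - J a c d \<star> b + J a b d \<star> c - J a b c \<star> d"

text \<open>In the sum over the six pairs the products of products \<open>(c \<star> d) \<star> (a \<star> b)\<close> cancel, and the
  twelve remaining monomials \<open>((a \<star> b) \<star> c) \<star> d\<close> are those of the right-hand side.\<close>

lemma alternating_sum_jacobian:
  "J (a \<star> b) c d + J (c \<star> d) a b - J (a \<star> c) b d - J (b \<star> d) a c
     + J (a \<star> d) b c + J (b \<star> c) a d = - jacobian_boundary a b c d"
  \<comment> \<open>The instances of skew-symmetry rewrite every monomial to a left-normed one, or to a fixed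
    one of the products of products, so that equal monomials become syntactically equal.\<close>
  by (simp add: jacobian_boundary_def jacobian_def mult_linear_simps algebra_simps
      skew[of b a] skew[of c a] skew[of c b] skew[of d a] skew[of d b] skew[of d c]
      skew[of a "p \<star> q" for p q] skew[of b "p \<star> q" for p q]
      skew[of c "p \<star> q" for p q] skew[of d "p \<star> q" for p q]
      skew[of "c \<star> d" "a \<star> b"] skew[of "b \<star> d" "a \<star> c"] skew[of "b \<star> c" "a \<star> d"])

section \<open>Sagle's alternating function\<close>

definition sagle :: "'a \<Rightarrow> 'a \<Rightarrow> 'a \<Rightarrow> 'a \<Rightarrow> 'a" where
  "sagle a b c d = J (a \<star> b) c d - J b c d \<star> a + J a c d \<star> b"

lemma sagle_swap12: "sagle b a c d = - sagle a b c d"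
  using skew[of b a] by (simp add: sagle_def jacobian_def mult_linear_simps)

lemma sagle_swap34: "sagle a b d c = - sagle a b c d"
  using jacobian_swap23[of _ d c] by (simp add: sagle_def mult_linear_simps)

text \<open>The Malcev identity is the vanishing of \<open>sagle e b e d\<close>, since \<open>J e e d = 0\<close>; polarizing
  in \<open>e\<close> gives skew-symmetry. With the two preceding swaps this generates all permutations.\<close>

lemma sagle_swap13:
  assumes two: "(2::'k) \<noteq> 0"
  shows "sagle c b a d = - sagle a b c d"
proof -
  have vanish: "sagle e b e d = 0" for e
  proof -
    have "J (e \<star> b) e d = J e d (e \<star> b)" by (rule jacobian_cycle[symmetric])
    also have "\<dots> = J e d b \<star> e" by (rule malcev)
    also have "J e d b = J b e d" by (rule jacobian_cycle)
    finally have "J (e \<star> b) e d = J b e d \<star> e" .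
    moreover have "J e e d = 0"
      by (simp add: jacobian_def skew[of d e] mult_self[OF two] mult_linear_simps)
    ultimately show ?thesis by (simp add: sagle_def mult_linear_simps)
  qed
  have "sagle (a + c) b (a + c) d =
      sagle a b a d + sagle a b c d + sagle c b a d + sagle c b c d"
    by (simp add: sagle_def jacobian_def mult_linear_simps algebra_simps)
  then show ?thesis by (simp add: vanish eq_neg_iff_add_eq_0 add.commute)
qed

lemma sagle_swap23:
  assumes two: "(2::'k) \<noteq> 0"
  shows "sagle a c b d = - sagle a b c d"
  by (metis sagle_swap12 sagle_swap13[OF two])

lemma jacobian_product_left:
  "J (a \<star> b) c d = sagle a b c d + J b c d \<star> a - J a c d \<star> b"
  by (simp add: sagle_def)

text \<open>This is \<open>6 F + 4 G = 0\<close>, written as the double of \<open>3 F + 2 G\<close>, the value of the Leibniz defect.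
  Sum the definition of \<open>sagle\<close>, with signs, over the six pairs of arguments: the left-hand side
  is six times the same value, because \<open>sagle\<close> is alternating; the terms \<open>J (a \<star> b) c d\<close>
  contribute \<open>- jacobian_boundary\<close>, and each of the four terms of \<open>jacobian_boundary\<close> is
  subtracted three times, once for each pair that contains its outer factor.\<close>

lemma six_sagle:
  fixes a b c d :: 'a
  assumes two: "(2::'k) \<noteq> 0"
  defines "F \<equiv> sagle a b c d" and "G \<equiv> jacobian_boundary a b c d"
  shows "(F + F + F + G + G) + (F + F + F + G + G) = 0"
proof -
  note sw = sagle_swap12 sagle_swap34 sagle_swap23[OF two]
  have perms: "sagle c d a b = F" "sagle a c b d = - F" "sagle b d a c = - F"
    "sagle a d b c = F" "sagle b c a d = F"
    unfolding F_def by (metis sw)+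
  have jac: "J c b d = - J b c d" "J d b c = J b c d" "J d a c = J a c d" "J c a d = - J a c d"
    "J d a b = J a b d" "J b a d = - J a b d" "J c a b = J a b c" "J b a c = - J a b c"
    by (metis jacobian_cycle jacobian_swap12)+
  have "F + F + F + F + F + F =
      J (a \<star> b) c d + J (c \<star> d) a b - J (a \<star> c) b d - J (b \<star> d) a c
        + J (a \<star> d) b c + J (b \<star> c) a d - (G + G + G)"
    unfolding G_def jacobian_boundary_def jacobian_product_left perms F_def[symmetric] jac
    by (simp add: mult_linear_simps algebra_simps)
  then show ?thesis
    unfolding alternating_sum_jacobian G_def[symmetric]
    by (simp add: algebra_simps eq_neg_iff_add_eq_0)
qed

section \<open>The operators of the ternary product are derivations\<close>

definition inner_derivation :: "'a \<Rightarrow> 'a \<Rightarrow> 'a \<Rightarrow> 'a" where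
  "inner_derivation x y z = (x \<star> y) \<star> z - (y \<star> z) \<star> x - (z \<star> x) \<star> y"

text \<open>With \<open>L x z = x \<star> z\<close>, the operator \<open>inner_derivation x y\<close> is
  \<open>L (x \<star> y) + L x \<circ> L y - L y \<circ> L x\<close>, and the Leibniz defect of \<open>L x\<close> at \<open>u\<close>, \<open>v\<close> is
  \<open>- J x u v\<close>; the formula is the resulting defect of the sum and of the commutator.\<close>

lemma leibniz_defect_jacobian:
  "inner_derivation x y (u \<star> v) - inner_derivation x y u \<star> v - u \<star> inner_derivation x y v =
     - J (x \<star> y) u v + J y u v \<star> x - J x u v \<star> y
     + J (x \<star> u) v y + J (x \<star> v) y u - J (y \<star> u) v x - J (y \<star> v) x u"
  by (simp add: inner_derivation_def jacobian_def mult_linear_simps algebra_simps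
      skew[of y x] skew[of u x] skew[of u y] skew[of v x] skew[of v y] skew[of v u]
      skew[of x "p \<star> q" for p q] skew[of y "p \<star> q" for p q]
      skew[of u "p \<star> q" for p q] skew[of v "p \<star> q" for p q]
      skew[of "u \<star> v" "x \<star> y"] skew[of "y \<star> v" "x \<star> u"] skew[of "y \<star> u" "x \<star> v"])

lemma leibniz_defect_sagle:
  fixes x y u v :: 'a
  assumes two: "(2::'k) \<noteq> 0"
  defines "F \<equiv> sagle x y u v" and "G \<equiv> jacobian_boundary x y u v"
  shows "inner_derivation x y (u \<star> v) - inner_derivation x y u \<star> v - u \<star> inner_derivation x y v =
     F + F + F + G + G"
proof -
  note sw = sagle_swap12 sagle_swap34 sagle_swap23[OF two]
  have perms: "sagle x u v y = F" "sagle x v y u = F" "sagle y u v x = - F" "sagle y v x u = - F"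
    unfolding F_def by (metis sw)+
  have jac: "J u v y = J y u v" "J v y u = J y u v" "J u v x = J x u v" "J v x u = J x u v"
    "J x v y = - J x y v" "J y v x = J x y v" "J y x u = - J x y u"
    by (metis jacobian_cycle jacobian_swap12)+
  show ?thesis
    unfolding leibniz_defect_jacobian jacobian_product_left perms F_def[symmetric] jac
      G_def jacobian_boundary_def
    by (simp add: mult_linear_simps algebra_simps)
qed

theorem inner_derivation_mult:
  assumes "(2::'k) \<noteq> 0"
  shows "inner_derivation x y (u \<star> v) = inner_derivation x y u \<star> v + u \<star> inner_derivation x y v"
  using leibniz_defect_sagle[OF assms, of x y u v]
    double_eq_zero_imp[OF assms six_sagle[OF assms, of x y u v]]
  by (simp add: algebra_simps)

lemma inner_derivation_linear_simps:
  "inner_derivation (x + x') y z = inner_derivation x y z + inner_derivation x' y z"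
  "inner_derivation x (y + y') z = inner_derivation x y z + inner_derivation x y' z"
  "inner_derivation x y (z + z') = inner_derivation x y z + inner_derivation x y z'"
  "inner_derivation x y (z - z') = inner_derivation x y z - inner_derivation x y z'"
  "inner_derivation (c *s x) y z = c *s inner_derivation x y z"
  "inner_derivation x (c *s y) z = c *s inner_derivation x y z"
  "inner_derivation x y (c *s z) = c *s inner_derivation x y z"
  by (simp_all add: inner_derivation_def mult_linear_simps algebra_simps)

lemma inner_derivation_swap: "inner_derivation y x z = - inner_derivation x y z"
  using skew[of y x] skew[of z x] skew[of y z]
  by (simp add: inner_derivation_def mult_linear_simps)

text \<open>A derivation of the product is a derivation of every operation composed from it; this
  untwisted (B8) applies that to \<open>inner_derivation\<close> itself.\<close>

lemma inner_derivation_inner_derivation: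
  assumes "(2::'k) \<noteq> 0"
  shows "inner_derivation x y (inner_derivation u v w) =
    inner_derivation (inner_derivation x y u) v w + inner_derivation u (inner_derivation x y v) w
    + inner_derivation u v (inner_derivation x y w)"
  unfolding inner_derivation_def[of u v w] inner_derivation_def[of u v "inner_derivation x y w"]
    inner_derivation_def[of "inner_derivation x y u" v w]
    inner_derivation_def[of u "inner_derivation x y v" w]
  by (simp add: inner_derivation_linear_simps inner_derivation_mult[OF assms]
      mult_linear_simps algebra_simps)

lemma cyclic_sum_inner_derivation:
  "cyclic_sum (\<lambda>x y z. (x \<star> y) \<star> z + inner_derivation x y z) x y z = 0"
  by (simp add: cyclic_sum_def inner_derivation_def)

end

section \<open>Twisting by an endomorphism\<close>

theorem corollary3p3:
  fixes scale :: "'k::field_char_0 \<Rightarrow> 'a::ab_group_add \<Rightarrow> 'a"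
    and mult :: "'a \<Rightarrow> 'a \<Rightarrow> 'a" (infixl \<open>\<star>\<close> 70)
    and \<beta> :: "'a \<Rightarrow> 'a"
  assumes "malcev_algebra scale mult"
    and "algebra_endomorphism scale mult \<beta>"
  shows "hom_lie_yamaguti_algebra scale
           (\<lambda>x y. \<beta> (x \<star> y))
           (\<lambda>x y z. (\<beta> ^^ 2) ((x \<star> y) \<star> z - (y \<star> z) \<star> x - (z \<star> x) \<star> y))
           \<beta>"
proof -
  interpret malcev_algebra scale mult by fact
  have two: "(2::'k) \<noteq> 0" by simp
  have lin: "Vector_Spaces.linear scale scale \<beta>" and hom: "\<beta> (x \<star> y) = \<beta> x \<star> \<beta> y" for x y
    using assms(2) by (simp_all add: algebra_endomorphism_def)
  interpret \<beta>: module_hom scale scale \<beta> by (rule module_hom_linearI[OF lin])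
  note \<beta>_simps = \<beta>.add \<beta>.neg \<beta>.diff \<beta>.scale hom
  have hom3: "\<beta> (inner_derivation x y z) = inner_derivation (\<beta> x) (\<beta> y) (\<beta> z)" for x y z
    by (simp add: inner_derivation_def \<beta>_simps)
  \<comment> \<open>Moves all occurrences of \<open>\<beta>\<close> to the variables and spells out its iterates.\<close>
  note push = \<beta>_simps hom3 eval_nat_numeral
  have "hom_lie_yamaguti_algebra scale (\<lambda>x y. \<beta> (x \<star> y))
      (\<lambda>x y z. (\<beta> ^^ 2) (inner_derivation x y z)) \<beta>"
  proof (unfold_locales, goal_cases bilinear trilinear B1 B2 B3 B4 B5 B6 B7 B8)
    case bilinear
    show ?case
      by (simp add: bilinear_op_def Vector_Spaces.linear_iff vector_space_axioms
          mult_linear_simps \<beta>_simps)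
  next
    case trilinear
    show ?case
      by (simp add: trilinear_op_def Vector_Spaces.linear_iff vector_space_axioms
          inner_derivation_linear_simps push)
  next
    case (B1 x y)
    show ?case by (simp add: hom)
  next
    case (B2 x y z)
    show ?case by (simp add: push)
  next
    case (B3 x y)
    show ?case using skew[of "\<beta> x" "\<beta> y"] by (simp add: hom)
  next
    case (B4 x y z)
    show ?case by (subst inner_derivation_swap) (simp add: push)
  next
    case (B5 x y z)
    show ?case
      using cyclic_sum_inner_derivation[of "\<beta> (\<beta> x)" "\<beta> (\<beta> y)" "\<beta> (\<beta> z)"]
      by (simp add: cyclic_sum_def push)
  next
    case (B6 u x y z)
    have "inner_derivation (b \<star> a) c d = - inner_derivation (a \<star> b) c d" for a b c d
      by (subst skew) (simp add: inner_derivation_def mult_linear_simps)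
    from this[of "\<beta> (\<beta> (\<beta> x))" "\<beta> (\<beta> (\<beta> y))"] this[of "\<beta> (\<beta> (\<beta> y))" "\<beta> (\<beta> (\<beta> z))"]
      this[of "\<beta> (\<beta> (\<beta> z))" "\<beta> (\<beta> (\<beta> x))"]
    show ?case by (simp add: cyclic_sum_def push)
  next
    case (B7 x y u v)
    show ?case by (simp add: push inner_derivation_mult[OF two])
  next
    case (B8 x y u v w)
    show ?case
      unfolding eval_nat_numeral
      by (simp add: push inner_derivation_inner_derivation[OF two, of "\<beta> (\<beta> (\<beta> (\<beta> x)))"])
  qed
  then show ?thesis by (simp only: inner_derivation_def)
qed

end
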